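(* Let $\pi$ be a minimal valid function (for a fixed $f \in \mathbb{R}\setminus\mathbb{Z}$) that is piecewise linear (possibly discontinuous) over $\mathcal{P}$. Let $F$ be a two-dimensional additive face of $\Delta\mathcal{P}$. Let $\theta=\pi$ or $\theta=\tilde\pi$ for some effective perturbation function $\tilde{\pi} \in \tilde{\Pi}^{\pi}(\mathbb{R},\mathbb{Z})$. Then $\theta$ is affine with the same slope over the open intervals $\operatorname{int}(p_1(F))$, $\operatorname{int}(p_2(F))$, and $\operatorname{int}(p_3(F))$; that is, there is one $c\in\mathbb{R}$ such that on each of these three intervals $\theta$ is an affine function with slope $c$.
   Context: Fix $f \in \mathbb{R}\setminus\mathbb{Z}$. A function $\pi\colon\mathbb{R}\to\mathbb{R}$ is a minimal valid function if it is $\mathbb{Z}$-periodic, $\pi(0)=0$, $\pi(f)=1$, $\pi(x)\ge 0$ for all $x\in\mathbb{R}$, $\pi(x)+\pi(f-x)=1$ for all $x\in\mathbb{R}$, and $\pi(x)+\pi(y)\ge\pi(x+y)$ for all $x,y\in\mathbb{R}$. Effective perturbations: a function $\tilde\pi\colon\mathbb{R}\to\mathbb{R}$ is an effective perturbation function for a minimal valid function $\pi$, written $\tilde\pi\in\tilde\Pi^{\pi}(\mathbb{R},\mathbb{Z})$, if there exists $\epsilon>0$ such that $\pi+\epsilon\tilde\pi$ and $\pi-\epsilon\tilde\pi$ are both minimal valid functions (for the same $f$). Piecewise linear functions: let $0=x_0<x_1<\dots<x_n=1$ and $B=\{x_i+t : 0\le i\le n-1,\ t\in\mathbb{Z}\}$.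 Let $\mathcal{P}=\mathcal{P}_B$ be the collection of all singletons $\{x\}$, $x\in B$ (zero-dimensional faces), and all closed intervals $[x_i+t,x_{i+1}+t]$, $0\le i\le n-1$, $t\in\mathbb{Z}$ (one-dimensional faces). A $\mathbb{Z}$-periodic function $\pi$ is piecewise linear over $\mathcal{P}$ if it is affine on the relative interior of each face of $\mathcal{P}$; it may be discontinuous at points of $B$. The complex $\Delta\mathcal{P}$: its faces are the nonempty sets $F=F(I,J,K)=\{(x,y)\in\mathbb{R}\times\mathbb{R} : x\in I,\ y\in J,\ x+y\in K\}$ for $I,J,K\in\mathcal{P}$. Let $p_1(x,y)=x$, $p_2(x,y)=y$, $p_3(x,y)=x+y$. Subadditivity slack: for $\theta\colon\mathbb{R}\to\mathbb{R}$ let $\Delta\theta(x,y)=\theta(x)+\theta(y)-\theta(x+y)$, and for a face $F$ of $\Delta\mathcal{P}$ and $(x,y)\in F$ let $\Delta\theta_F(x,y)=\lim_{(u,v)\to(x,y),\ (u,v)\in\operatorname{rel\,int}(F)}\Delta\theta(u,v)$. Additive faces: for a subadditive function $\pi$ that is piecewise linear over $\mathcal{P}$, a face $F\in\Delta\mathcal{P}$ is additive if $F$ is contained in a face $F'\in\Delta\mathcal{P}$ (possibly $F'=F$) such that $\Delta\pi_{F'}(x,y)=0$ for all $(x,y)\in F$. *)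

theory Defs
  imports "HOL-Analysis.Analysis"
begin

definition Z_periodic :: "(real \<Rightarrow> real) \<Rightarrow> bool" where
  "Z_periodic g \<longleftrightarrow> (\<forall>x. \<forall>t::int. g (x + of_int t) = g x)"

definition minimal_valid :: "real \<Rightarrow> (real \<Rightarrow> real) \<Rightarrow> bool" where
  "minimal_valid f \<pi> \<longleftrightarrow>
     Z_periodic \<pi> \<and> \<pi> 0 = 0 \<and> \<pi> f = 1 \<and>
     (\<forall>x. \<pi> x \<ge> 0) \<and>
     (\<forall>x. \<pi> x + \<pi> (f - x) = 1) \<and>
     (\<forall>x y. \<pi> x + \<pi> y \<ge> \<pi> (x + y))"

definition effective_perturbations :: "real \<Rightarrow> (real \<Rightarrow> real) \<Rightarrow> (real \<Rightarrow> real) set" where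
  "effective_perturbations f \<pi> =
     {\<pi>'. \<exists>\<epsilon>>0. minimal_valid f (\<lambda>x. \<pi> x + \<epsilon> * \<pi>' x) \<and>
                minimal_valid f (\<lambda>x. \<pi> x - \<epsilon> * \<pi>' x)}"

text \<open>Only the values \<open>x 0, \<dots>, x n\<close> of the sequence \<open>x\<close> matter.\<close>

definition subdivision :: "nat \<Rightarrow> (nat \<Rightarrow> real) \<Rightarrow> bool" where
  "subdivision n x \<longleftrightarrow> x 0 = 0 \<and> x n = 1 \<and> (\<forall>i<n. x i < x (Suc i))"

definition breakpoints :: "nat \<Rightarrow> (nat \<Rightarrow> real) \<Rightarrow> real set" where
  "breakpoints n x = {x i + of_int t | i (t::int). i < n}"

definition P_complex :: "nat \<Rightarrow> (nat \<Rightarrow> real) \<Rightarrow> real set set" where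
  "P_complex n x =
     {{b} | b. b \<in> breakpoints n x} \<union>
     {{x i + of_int t .. x (Suc i) + of_int t} | i (t::int). i < n}"

definition affine_with_slope_on :: "real set \<Rightarrow> real \<Rightarrow> (real \<Rightarrow> real) \<Rightarrow> bool" where
  "affine_with_slope_on S c g \<longleftrightarrow> (\<exists>d. \<forall>x\<in>S. g x = c * x + d)"

definition piecewise_linear_over :: "real set set \<Rightarrow> (real \<Rightarrow> real) \<Rightarrow> bool" where
  "piecewise_linear_over P g \<longleftrightarrow>
     Z_periodic g \<and> (\<forall>I\<in>P. \<exists>c. affine_with_slope_on (rel_interior I) c g)"

definition p1 :: "real \<times> real \<Rightarrow> real" where "p1 = (\<lambda>(x, y). x)"
definition p2 :: "real \<times> real \<Rightarrow> real" where "p2 = (\<lambda>(x, y). y)"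
definition p3 :: "real \<times> real \<Rightarrow> real" where "p3 = (\<lambda>(x, y). x + y)"

definition face_of_triple :: "real set \<Rightarrow> real set \<Rightarrow> real set \<Rightarrow> (real \<times> real) set" where
  "face_of_triple I J K = {(x, y). x \<in> I \<and> y \<in> J \<and> x + y \<in> K}"

definition Delta_complex :: "real set set \<Rightarrow> (real \<times> real) set set" where
  "Delta_complex P =
     {face_of_triple I J K | I J K. I \<in> P \<and> J \<in> P \<and> K \<in> P \<and> face_of_triple I J K \<noteq> {}}"

definition slack :: "(real \<Rightarrow> real) \<Rightarrow> real \<times> real \<Rightarrow> real" where
  "slack \<theta> = (\<lambda>(x, y). \<theta> x + \<theta> y - \<theta> (x + y))"

text \<open>
  The filter is not \<open>at z within rel_interior F\<close>, because the point \<open>z\<close> itself must be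
  admitted: for a singleton \<open>F = {z}\<close> the latter filter is trivial, whereas the limit
  is meant to be \<open>slack \<theta> z\<close>. For \<open>\<theta>\<close> piecewise linear over \<open>P\<close>, \<open>F \<in> Delta_complex P\<close>
  and \<open>z \<in> F\<close> the limit exists, since \<open>slack \<theta>\<close> is then affine on \<open>rel_interior F\<close>.
\<close>

definition slack_limit :: "(real \<Rightarrow> real) \<Rightarrow> (real \<times> real) set \<Rightarrow> real \<times> real \<Rightarrow> real" where
  "slack_limit \<theta> F z = Lim (inf (nhds z) (principal (rel_interior F))) (slack \<theta>)"

definition additive_face :: "real set set \<Rightarrow> (real \<Rightarrow> real) \<Rightarrow> (real \<times> real) set \<Rightarrow> bool" where
  "additive_face P \<pi> F \<longleftrightarrow>
     F \<in> Delta_complex P \<and>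
     (\<exists>F'\<in>Delta_complex P. F \<subseteq> F' \<and> (\<forall>z\<in>F. slack_limit \<pi> F' z = 0))"

end

theory Submission
  imports Defs
begin

text \<open>
  On the interior of an additive face the slack of \<open>\<pi>\<close> is continuous, so its vanishing limits say
  that \<open>\<pi> u + \<pi> v = \<pi> (u + v)\<close> there. An effective perturbation inherits this equation: the
  slacks of \<open>\<pi> + \<epsilon> \<theta>\<close> and \<open>\<pi> - \<epsilon> \<theta>\<close> are nonnegative, and where the slack of \<open>\<pi>\<close> is zero they
  are opposite numbers. Moreover minimal valid functions take values in \<open>[0, 1]\<close>, so that \<open>\<theta>\<close> is
  bounded in either case.

  What remains is a statement about Cauchy's functional equation restricted to a connected
  open subset of the plane (\<open>bounded_Pexider_affine\<close>). Near a point \<open>(a, b)\<close> of this set the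
  increments at \<open>a\<close>, at \<open>b\<close> and at \<open>a + b\<close> are one and the same function of the step, which is
  additive near \<open>0\<close> and bounded, hence linear (\<open>bounded_additive_linear\<close>). So the derivatives at
  \<open>a\<close>, \<open>b\<close> and \<open>a + b\<close> agree, and they do not change locally; by connectedness there is a single
  slope. Finally the projections commute with taking the relative interior of a convex set, so the
  projections of the interior of \<open>F\<close> cover the interiors of the projections.
\<close>

section \<open>Cauchy's equation on an open connected subset of the plane\<close>

text \<open>
  A linear term can be subtracted so that the remainder \<open>r\<close> vanishes at \<open>d = e / 2\<close>. Then
  \<open>2 * r t\<close> is \<open>r (2 * t)\<close>, and also \<open>r (2 * t - d)\<close>. For \<open>t\<close> in \<open>[0, d]\<close> one of these two
  arguments is again in \<open>[0, d]\<close>, so every bound for \<open>r\<close> on \<open>[0, d]\<close> can be halved.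
\<close>

lemma bounded_additive_linear:
  fixes m :: "real \<Rightarrow> real"
  assumes e: "e > 0"
    and add: "\<And>s t. \<bar>s\<bar> < e \<Longrightarrow> \<bar>t\<bar> < e \<Longrightarrow> m (s + t) = m s + m t"
    and bnd: "\<And>s. \<bar>s\<bar> < e \<Longrightarrow> \<bar>m s\<bar> \<le> M"
  shows "\<exists>c. \<forall>s. \<bar>s\<bar> < e \<longrightarrow> m s = c * s"
proof -
  define d where "d = e / 2"
  have d: "0 < d" "d < e" "e = 2 * d" using e by (auto simp: d_def)
  define c where "c = m d / d"
  define r where "r s = m s - c * s" for s
  have r_add: "r (s + t) = r s + r t" if "\<bar>s\<bar> < e" "\<bar>t\<bar> < e" for s t
    using add[OF that] by (simp add: r_def algebra_simps)
  have r_d: "r d = 0" using d by (simp add: r_def c_def)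
  have r_bnd: "\<bar>r t\<bar> \<le> M + \<bar>c\<bar> * d" if t: "0 \<le> t" "t \<le> d" for t
  proof -
    have "\<bar>m t\<bar> \<le> M" using bnd t d by auto
    moreover have "\<bar>c * t\<bar> \<le> \<bar>c\<bar> * d" using t by (simp add: abs_mult mult_left_mono)
    ultimately show ?thesis unfolding r_def by linarith
  qed
  have halved: "\<bar>r t\<bar> \<le> (M + \<bar>c\<bar> * d) / 2 ^ n" if "0 \<le> t" "t \<le> d" for n t
    using that
  proof (induction n arbitrary: t)
    case 0
    then show ?case using r_bnd by simp
  next
    case (Suc n)
    have double: "r (2 * t) = 2 * r t" using r_add[of t t] Suc.prems d by simp
    have "\<bar>2 * r t\<bar> \<le> (M + \<bar>c\<bar> * d) / 2 ^ n"
    proof (cases "2 * t \<le> d")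
      case True
      then show ?thesis using Suc.IH[of "2 * t"] Suc.prems double by simp
    next
      case False
      then have "r (2 * t) = r (2 * t - d)"
        using r_add[of "2 * t - d" d] Suc.prems d r_d by simp
      then show ?thesis using Suc.IH[of "2 * t - d"] Suc.prems False double by simp
    qed
    then show ?case by (simp add: abs_mult field_simps)
  qed
  have r_pos: "r t = 0" if t: "0 \<le> t" "t \<le> d" for t
  proof -
    have "(\<lambda>n. (M + \<bar>c\<bar> * d) * (1 / 2) ^ n) \<longlonglongrightarrow> (M + \<bar>c\<bar> * d) * 0"
      by (intro tendsto_mult tendsto_const LIMSEQ_realpow_zero) auto
    then have "(\<lambda>n. (M + \<bar>c\<bar> * d) / 2 ^ n) \<longlonglongrightarrow> 0"
      by (simp add: power_divide)
    then have "\<bar>r t\<bar> \<le> 0"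
      by (rule LIMSEQ_le_const) (use halved[OF t] in auto)
    then show ?thesis by simp
  qed
  have r_0: "r 0 = 0" using r_pos d by simp
  have "r s = 0" if s: "\<bar>s\<bar> < e" for s
  proof -
    have h: "r (s / 2) = 0"
    proof (cases "s \<ge> 0")
      case True
      then show ?thesis using r_pos[of "s / 2"] s d by simp
    next
      case False
      then have "r (- s / 2) = 0" using r_pos[of "- s / 2"] s d by simp
      then show ?thesis using r_add[of "s / 2" "- s / 2"] s r_0 by simp
    qed
    show ?thesis using r_add[of "s / 2" "s / 2"] s h by simp
  qed
  then show ?thesis unfolding r_def by (metis eq_iff_diff_eq_0)
qed

text \<open>
  With \<open>m s = k (a + b + s) - k (a + b)\<close>, putting one of the two steps to zero in the equation
  shows that the increments of \<open>g\<close> at \<open>a\<close> and of \<open>h\<close> at \<open>b\<close> are also given by \<open>m\<close>; the general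
  case of the equation then says that \<open>m\<close> is additive.
\<close>

lemma bounded_Pexider_locally_affine:
  fixes g h k :: "real \<Rightarrow> real"
  assumes U: "open U" "(a, b) \<in> U"
    and eq: "\<And>u v. (u, v) \<in> U \<Longrightarrow> g u + h v = k (u + v)"
    and bnd: "\<And>u v. (u, v) \<in> U \<Longrightarrow> \<bar>k (u + v)\<bar> \<le> M"
  shows "\<exists>e>0. \<exists>c. \<forall>s. \<bar>s\<bar> < e \<longrightarrow>
      g (a + s) = g a + c * s \<and> h (b + s) = h b + c * s \<and> k (a + b + s) = k (a + b) + c * s"
proof -
  obtain A B where AB: "open A" "open B" "(a, b) \<in> A \<times> B" "A \<times> B \<subseteq> U"
    using U by (rule open_prod_elim)
  obtain e1 where e1: "e1 > 0" "ball a e1 \<subseteq> A" using AB openE[of A a] by auto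
  obtain e2 where e2: "e2 > 0" "ball b e2 \<subseteq> B" using AB openE[of B b] by auto
  define e where "e = min e1 e2"
  have e: "e > 0" using e1 e2 by (simp add: e_def)
  have box: "(a + s, b + t) \<in> U" if "\<bar>s\<bar> < e" "\<bar>t\<bar> < e" for s t
  proof -
    have "a + s \<in> A" "b + t \<in> B"
      using that e1 e2 by (auto simp: e_def dist_real_def)
    then show ?thesis using AB by auto
  qed
  have both: "g (a + s) + h (b + t) = k (a + b + (s + t))" if "\<bar>s\<bar> < e" "\<bar>t\<bar> < e" for s t
    using eq[OF box[OF that]] by (simp add: ac_simps)
  define m where "m s = k (a + b + s) - k (a + b)" for s
  have k0: "k (a + b) = g a + h b" using both[of 0 0] e by simp
  have g_m: "g (a + s) = g a + m s" if "\<bar>s\<bar> < e" for s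
    using both[of s 0] that e k0 by (simp add: m_def)
  have h_m: "h (b + s) = h b + m s" if "\<bar>s\<bar> < e" for s
    using both[of 0 s] that e k0 by (simp add: m_def)
  have "m (s + t) = m s + m t" if "\<bar>s\<bar> < e" "\<bar>t\<bar> < e" for s t
    using both[OF that] g_m[OF that(1)] h_m[OF that(2)] k0 by (simp add: m_def)
  moreover have "\<bar>m s\<bar> \<le> 2 * M" if "\<bar>s\<bar> < e" for s
    using bnd[OF box[of s 0]] bnd[OF box[of 0 0]] that e by (simp add: m_def ac_simps)
  ultimately obtain c where c: "\<forall>s. \<bar>s\<bar> < e \<longrightarrow> m s = c * s"
    using bounded_additive_linear[OF e] by blast
  have "k (a + b + s) = k (a + b) + c * s" if "\<bar>s\<bar> < e" for s
    using c that unfolding m_def by (simp add: diff_eq_eq)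
  then show ?thesis using e g_m h_m c by (intro exI[of _ e] exI[of _ c] conjI) auto
qed

lemma affine_near_imp_DERIV:
  fixes g :: "real \<Rightarrow> real"
  assumes "e > 0" "\<And>s. \<bar>s\<bar> < e \<Longrightarrow> g (a + s) = g a + c * s" "\<bar>y - a\<bar> < e"
  shows "(g has_field_derivative c) (at y)"
proof -
  have "((\<lambda>u. g a + c * (u - a)) has_field_derivative c) (at y)"
    by (auto intro!: derivative_eq_intros)
  moreover have "y \<in> ball a e" using assms(3) by (auto simp: dist_real_def)
  moreover have "g a + c * (u - a) = g u" if "u \<in> ball a e" for u
    using assms(2)[of "u - a"] that by (auto simp: dist_real_def)
  ultimately show ?thesis
    using has_field_derivative_transform_within_open[of _ c y "ball a e" g] by auto
qed

lemma DERIV_const_imp_affine: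
  assumes "open S" "connected S" "\<And>y. y \<in> S \<Longrightarrow> (g has_field_derivative c) (at y)"
  shows "affine_with_slope_on S c g"
proof -
  have "((\<lambda>u. g u - c * u) has_field_derivative 0) (at y)" if "y \<in> S" for y
    using assms(3)[OF that] by (auto intro!: derivative_eq_intros)
  then have "(\<lambda>u. g u - c * u) constant_on S"
    using assms(1,2) by (intro has_field_derivative_0_imp_constant_on) auto
  then obtain d where "\<And>y. y \<in> S \<Longrightarrow> g y - c * y = d"
    unfolding constant_on_def by blast
  then show ?thesis unfolding affine_with_slope_on_def by (metis diff_eq_eq add.commute)
qed

lemma linear_p: "linear p1" "linear p2" "linear p3"
  by (auto intro!: linearI simp: p1_def p2_def p3_def algebra_simps split: prod.splits)

lemma surj_p: "surj p1" "surj p2" "surj p3"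
proof -
  show "surj p1" by (rule surjI[of _ "\<lambda>y. (y, 0)"]) (simp add: p1_def)
  show "surj p2" by (rule surjI[of _ "\<lambda>y. (0, y)"]) (simp add: p2_def)
  show "surj p3" by (rule surjI[of _ "\<lambda>y. (y, 0)"]) (simp add: p3_def)
qed

theorem bounded_Pexider_affine:
  fixes g h k :: "real \<Rightarrow> real"
  assumes U: "open U" "connected U"
    and eq: "\<And>u v. (u, v) \<in> U \<Longrightarrow> g u + h v = k (u + v)"
    and bnd: "\<And>u v. (u, v) \<in> U \<Longrightarrow> \<bar>k (u + v)\<bar> \<le> M"
  shows "\<exists>c. affine_with_slope_on (p1 ` U) c g \<and> affine_with_slope_on (p2 ` U) c h \<and>
             affine_with_slope_on (p3 ` U) c k"
proof (cases "U = {}")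
  case True
  then show ?thesis by (simp add: affine_with_slope_on_def)
next
  case False
  define D where "D z = deriv g (p1 z)" for z
  have local: "(g has_field_derivative D z) (at (p1 z)) \<and>
      (h has_field_derivative D z) (at (p2 z)) \<and>
      (k has_field_derivative D z) (at (p3 z)) \<and>
      (\<forall>\<^sub>F w in at z within U. D z = D w)" if z: "z \<in> U" for z
  proof -
    obtain a b where ab: "z = (a, b)" by (cases z)
    obtain e c where e: "e > 0"
      and g: "\<And>s. \<bar>s\<bar> < e \<Longrightarrow> g (a + s) = g a + c * s"
      and h: "\<And>s. \<bar>s\<bar> < e \<Longrightarrow> h (b + s) = h b + c * s"
      and k: "\<And>s. \<bar>s\<bar> < e \<Longrightarrow> k (a + b + s) = k (a + b) + c * s"
      using bounded_Pexider_locally_affine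
        [where g = g and h = h and k = k and M = M, OF U(1) z[unfolded ab] eq bnd]
      by auto
    have g': "deriv g y = c" if "\<bar>y - a\<bar> < e" for y
      by (rule DERIV_imp_deriv, rule affine_near_imp_DERIV[OF e g that])
    have D: "D z = c" using g'[of a] e ab by (simp add: D_def p1_def)
    have "D w = c" if "dist w z < e" for w
    proof -
      have "dist (fst w) a < e" using dist_fst_le[of w z] that ab by simp
      then show ?thesis using g' by (auto simp: D_def p1_def dist_real_def case_prod_beta)
    qed
    then have "\<forall>\<^sub>F w in at z within U. D z = D w"
      unfolding eventually_at using e D by auto
    then show ?thesis
      using affine_near_imp_DERIV[OF e g, of a] affine_near_imp_DERIV[OF e h, of b]
        affine_near_imp_DERIV[OF e k, of "a + b"] e D ab
      by (simp add: p1_def p2_def p3_def)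
  qed
  obtain z0 where z0: "z0 \<in> U" using False by auto
  have const: "D z = D z0" if "z \<in> U" for z
    using connected_local_const[OF U(2) that z0, of D] local by blast
  have "open (p ` U)" "connected (p ` U)" if "linear p" "surj p" for p :: "real \<times> real \<Rightarrow> real"
    using that U by (auto intro!: open_surjective_linear_image connected_continuous_image
        linear_continuous_on simp: linear_conv_bounded_linear)
  then have "affine_with_slope_on (p1 ` U) (D z0) g" "affine_with_slope_on (p2 ` U) (D z0) h"
    "affine_with_slope_on (p3 ` U) (D z0) k"
    using linear_p surj_p local const by (auto intro!: DERIV_const_imp_affine)
  then show ?thesis by blast
qed

section \<open>Additivity on the interior of a face\<close>

lemma convex_P_complex: "I \<in> P_complex n x \<Longrightarrow> convex I"
  by (auto simp: P_complex_def)

lemma face_of_triple_eq: "face_of_triple I J K = p1 -` I \<inter> p2 -` J \<inter> p3 -` K"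
  by (auto simp: face_of_triple_def p1_def p2_def p3_def)

lemma convex_face_of_triple:
  assumes "convex I" "convex J" "convex K"
  shows "convex (face_of_triple I J K)"
  unfolding face_of_triple_eq
  by (intro convex_Int convex_linear_vimage linear_p assms)

lemma convex_Delta_complex: "F \<in> Delta_complex (P_complex n x) \<Longrightarrow> convex F"
  by (auto simp: Delta_complex_def intro: convex_face_of_triple convex_P_complex)

lemma rel_interior_eq_interior_of_aff_dim_2:
  fixes F :: "(real \<times> real) set"
  assumes "aff_dim F = 2"
  shows "rel_interior F = interior F"
  using assms by (intro rel_interior_interior) (simp add: aff_dim_eq_full[symmetric])

lemma isCont_affine_interior:
  assumes "affine_with_slope_on (rel_interior I) c g" "a \<in> interior I"
  shows "isCont g a"
proof -
  obtain d where d: "\<forall>y\<in>rel_interior I. g y = c * y + d"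
    using assms(1) unfolding affine_with_slope_on_def by blast
  have "continuous_on (interior I) (\<lambda>y. c * y + d)" by (intro continuous_intros)
  then have "continuous_on (interior I) g"
    using d interior_subset_rel_interior by (smt (verit) continuous_on_cong subsetD)
  then show ?thesis using assms(2) continuous_on_eq_continuous_at open_interior by blast
qed

text \<open>
  The projections are open maps, so an interior point of \<open>face_of_triple I J K\<close> has its three
  projections in the interiors of \<open>I\<close>, \<open>J\<close> and \<open>K\<close>, where \<open>g\<close> is affine.
\<close>

lemma isCont_slack:
  assumes pl: "piecewise_linear_over P g" and F: "F \<in> Delta_complex P" and z: "z \<in> interior F"
  shows "isCont (slack g) z"
proof -
  obtain I J K where IJK: "I \<in> P" "J \<in> P" "K \<in> P" "F = face_of_triple I J K"
    using F unfolding Delta_complex_def by blast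
  have proj: "isCont (\<lambda>w. g (p w)) z"
    if p: "linear p" "surj p" and L: "L \<in> P" "p ` F \<subseteq> L" for p :: "real \<times> real \<Rightarrow> real" and L
  proof -
    have "open (p ` interior F)"
      using p open_surjective_linear_image by blast
    then have "p ` interior F \<subseteq> interior L"
      using L(2) interior_subset by (intro interior_maximal) blast+
    then have "p z \<in> interior L" using z by blast
    then have "isCont g (p z)"
      using pl L(1) isCont_affine_interior unfolding piecewise_linear_over_def by blast
    moreover have "isCont p z" using p(1) by (simp add: linear_continuous_at linear_conv_bounded_linear)
    ultimately show ?thesis using isCont_o2 by blast
  qed
  have "p1 ` F \<subseteq> I" "p2 ` F \<subseteq> J" "p3 ` F \<subseteq> K"
    using IJK(4) by (auto simp: face_of_triple_eq)
  then have "isCont (\<lambda>w. g (p1 w) + g (p2 w) - g (p3 w)) z"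
    using IJK linear_p surj_p by (intro continuous_intros proj)
  moreover have "slack g = (\<lambda>w. g (p1 w) + g (p2 w) - g (p3 w))"
    by (auto simp: slack_def p1_def p2_def p3_def)
  ultimately show ?thesis by simp
qed

lemma slack_limit_eq_slack:
  assumes "isCont (slack g) z" "z \<in> rel_interior F"
  shows "slack_limit g F z = slack g z"
proof -
  have "(slack g \<longlongrightarrow> slack g z) (nhds z)"
    using assms(1) by (simp add: isCont_def tendsto_at_iff_tendsto_nhds)
  then have lim: "(slack g \<longlongrightarrow> slack g z) (inf (nhds z) (principal (rel_interior F)))"
    by (rule tendsto_mono[rotated]) simp
  have "inf (nhds z) (principal (rel_interior F)) \<noteq> bot"
    using assms(2) eventually_nhds_x_imp_x[of "\<lambda>w. w \<notin> rel_interior F" z]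
    by (auto simp: trivial_limit_def eventually_inf_principal)
  then show ?thesis unfolding slack_limit_def using lim by (rule tendsto_Lim)
qed

text \<open>
  A face that contains \<open>F\<close> is two-dimensional as well, so its relative interior contains the
  interior of \<open>F\<close>.
\<close>

lemma additive_face_slack_eq_0:
  assumes pl: "piecewise_linear_over P g" and add: "additive_face P g F"
    and dim: "aff_dim F = 2" and z: "z \<in> interior F"
  shows "slack g z = 0"
proof -
  obtain F' where F': "F' \<in> Delta_complex P" "F \<subseteq> F'" "\<forall>z\<in>F. slack_limit g F' z = 0"
    using add unfolding additive_face_def by blast
  have z': "z \<in> interior F'" using z F'(2) interior_mono by blast
  have "aff_dim F' = 2"
    using aff_dim_subset[OF F'(2)] aff_dim_le_DIM[of F'] dim by simp
  then have "slack_limit g F' z = slack g z"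
    using z' isCont_slack[OF pl F'(1) z']
    by (intro slack_limit_eq_slack) (simp_all add: rel_interior_eq_interior_of_aff_dim_2)
  then show ?thesis using F'(3) z interior_subset by fastforce
qed

section \<open>Minimal valid functions and their perturbations\<close>

lemma minimal_valid_bounds:
  assumes "minimal_valid f g"
  shows "0 \<le> g y" "g y \<le> 1"
proof -
  have "0 \<le> g y" "0 \<le> g (f - y)" "g y + g (f - y) = 1"
    using assms unfolding minimal_valid_def by auto
  then show "0 \<le> g y" "g y \<le> 1" by linarith+
qed

lemma effective_perturbation_bounded:
  assumes "minimal_valid f \<pi>" "\<theta> \<in> effective_perturbations f \<pi>"
  shows "\<exists>M. \<forall>y. \<bar>\<theta> y\<bar> \<le> M"
proof -
  obtain \<epsilon> where \<epsilon>: "\<epsilon> > 0" "minimal_valid f (\<lambda>y. \<pi> y + \<epsilon> * \<theta> y)"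
    using assms(2) unfolding effective_perturbations_def by blast
  have "\<bar>\<theta> y\<bar> \<le> 1 / \<epsilon>" for y
  proof -
    have "\<bar>\<epsilon> * \<theta> y\<bar> \<le> 1"
      using minimal_valid_bounds[OF assms(1), of y] minimal_valid_bounds[OF \<epsilon>(2), of y] by linarith
    then show ?thesis using \<epsilon>(1) by (simp add: abs_mult field_simps)
  qed
  then show ?thesis by blast
qed

lemma effective_perturbation_slack_eq_0:
  assumes "\<theta> \<in> effective_perturbations f \<pi>" "slack \<pi> z = 0"
  shows "slack \<theta> z = 0"
proof -
  obtain \<epsilon> where \<epsilon>: "\<epsilon> > 0" "minimal_valid f (\<lambda>y. \<pi> y + \<epsilon> * \<theta> y)"
    "minimal_valid f (\<lambda>y. \<pi> y - \<epsilon> * \<theta> y)"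
    using assms(1) unfolding effective_perturbations_def by blast
  obtain u v where z: "z = (u, v)" by (cases z)
  have eq: "\<pi> u + \<pi> v - \<pi> (u + v) = 0" using assms(2) z by (simp add: slack_def)
  have "\<epsilon> * \<theta> u + \<epsilon> * \<theta> v - \<epsilon> * \<theta> (u + v) \<ge> 0"
    using \<epsilon>(2) eq unfolding minimal_valid_def by (smt (verit))
  moreover have "\<epsilon> * \<theta> u + \<epsilon> * \<theta> v - \<epsilon> * \<theta> (u + v) \<le> 0"
    using \<epsilon>(3) eq unfolding minimal_valid_def by (smt (verit))
  ultimately have "\<epsilon> * (\<theta> u + \<theta> v - \<theta> (u + v)) = 0" by (simp add: algebra_simps)
  then show ?thesis using \<epsilon>(1) z by (simp add: slack_def)
qed

section \<open>Affinity over the projections of an additive face\<close>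

lemma affine_with_slope_on_subset:
  "affine_with_slope_on T c g \<Longrightarrow> S \<subseteq> T \<Longrightarrow> affine_with_slope_on S c g"
  unfolding affine_with_slope_on_def by blast

theorem theorem6p2:
  fixes f :: real and \<pi> \<theta> :: "real \<Rightarrow> real"
    and n :: nat and x :: "nat \<Rightarrow> real" and F :: "(real \<times> real) set"
  assumes "f \<notin> \<int>"
    and "subdivision n x"
    and "minimal_valid f \<pi>"
    and "piecewise_linear_over (P_complex n x) \<pi>"
    and "additive_face (P_complex n x) \<pi> F"
    and "aff_dim F = 2"
    and "\<theta> = \<pi> \<or> \<theta> \<in> effective_perturbations f \<pi>"
  shows "\<exists>c. affine_with_slope_on (interior (p1 ` F)) c \<theta> \<and>
             affine_with_slope_on (interior (p2 ` F)) c \<theta> \<and>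
             affine_with_slope_on (interior (p3 ` F)) c \<theta>"
proof -
  have convF: "convex F"
    using assms(5) convex_Delta_complex unfolding additive_face_def by blast
  have slack0: "slack \<theta> z = 0" if "z \<in> interior F" for z
    using additive_face_slack_eq_0[OF assms(4,5,6) that] assms(7)
      effective_perturbation_slack_eq_0 by blast
  have "\<bar>\<pi> y\<bar> \<le> 1" for y
    using minimal_valid_bounds[OF assms(3), of y] by simp
  then obtain M where M: "\<And>y. \<bar>\<theta> y\<bar> \<le> M"
    using assms(7) effective_perturbation_bounded[OF assms(3)] by metis
  have "\<theta> u + \<theta> v = \<theta> (u + v)" if "(u, v) \<in> interior F" for u v
    using slack0[OF that] by (simp add: slack_def)
  then obtain c where c: "affine_with_slope_on (p1 ` interior F) c \<theta>"
    "affine_with_slope_on (p2 ` interior F) c \<theta>" "affine_with_slope_on (p3 ` interior F) c \<theta>"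
    using bounded_Pexider_affine[of "interior F" \<theta> \<theta> \<theta> M] M convF convex_connected convex_interior
    by blast
  have "interior (p ` F) \<subseteq> p ` interior F" if "linear p" for p :: "real \<times> real \<Rightarrow> real"
    using rel_interior_convex_linear_image[OF that convF] interior_subset_rel_interior[of "p ` F"]
      rel_interior_eq_interior_of_aff_dim_2[OF assms(6)] by simp
  then show ?thesis
    using c linear_p affine_with_slope_on_subset by blast
qed

end
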